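(* Every finite digraph with minimum out-degree at least $3$ has at least $2$ distinct friendly partitions.
   Context: Digraphs have no loops and no parallel arcs in the same direction. A friendly partition of a digraph $G=(V,E)$ is an (unordered) partition $\{V_1,V_2\}$ of $V$ into two nonempty sets such that every vertex has at least one out-neighbor in its own part. *)

theory Defs
  imports "Graph_Theory.Digraph" "HOL-Library.Disjoint_Sets"
begin

(* Meaningful only when the vertex set is finite and nonempty. *)
definition min_out_degree :: "('a, 'b) pre_digraph \<Rightarrow> nat" where
  "min_out_degree G = Min (out_degree G ` verts G)"

(* A partition is a set of parts, hence unordered; partition_on already excludes empty parts. *)
definition friendly_partition :: "('a, 'b) pre_digraph \<Rightarrow> 'a set set \<Rightarrow> bool" where
  "friendly_partition G P \<longleftrightarrow>
     partition_on (verts G) P \<and> card P = 2 \<and>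
     (\<forall>X\<in>P. \<forall>v\<in>X. \<exists>w\<in>X. v \<rightarrow>\<^bsub>G\<^esub> w)"

end

theory Submission
  imports Defs
begin

text \<open>
  Keep exactly three out-neighbours of every vertex and argue by induction on the number of
  vertices. Two disjoint nonempty sets without internal sinks always extend to a friendly
  partition, so besides one friendly partition it suffices to find such a pair separating two
  vertices that lie on the same side.

  If the ends of an arc have no common in-neighbour and the reverse arc is absent, contract the arc
  (Thomassen). Suppose no arc can be contracted. A digon \<open>{x, y}\<close> is one side of a friendly
  partition. If moving any single in-neighbour of the digon to its side fails, then counting shows
  that every in-neighbour dominates both \<open>x\<close> and \<open>y\<close> and exactly one further in-neighbour. If the
  remaining vertices contain no further such set, they have a source \<open>r\<close>, whose
  in-neighbours are \<open>x\<close> and \<open>y\<close>; as no arc leaving \<open>r\<close> can be contracted, the three out-neighbours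
  of \<open>r\<close> lie among the at most two remaining out-neighbours of \<open>x\<close> and \<open>y\<close>, which is absurd.

  Without digons, every in-neighbourhood has no internal source, so it has at least three elements,
  hence by double counting exactly three, and then in- and out-neighbourhoods have no internal sinks
  either. The partition separating the out- from the in-neighbourhood of a vertex \<open>w\<close> keeps some arc
  \<open>c \<rightarrow> a\<close> between out-neighbours of \<open>w\<close> on one side, and the corresponding partition for a vertex
  \<open>z\<close> with \<open>c \<rightarrow> z \<rightarrow> a\<close> separates \<open>a\<close> from \<open>c\<close>.
\<close>

section \<open>Sinks and friendly sides\<close>

definition sinks :: "('a \<Rightarrow> 'a set) \<Rightarrow> 'a set \<Rightarrow> 'a set" where
  "sinks N A = {v \<in> A. N v \<inter> A = {}}"

definition sources :: "('a \<Rightarrow> 'a set) \<Rightarrow> 'a set \<Rightarrow> 'a set" where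
  "sources N A = A - \<Union>(N ` A)"

definition in_nbhd :: "'a set \<Rightarrow> ('a \<Rightarrow> 'a set) \<Rightarrow> 'a set \<Rightarrow> 'a set" where
  "in_nbhd V N A = {u \<in> V - A. N u \<inter> A \<noteq> {}}"

lemma sinks_eq_empty_iff: "sinks N A = {} \<longleftrightarrow> (\<forall>v\<in>A. N v \<inter> A \<noteq> {})"
  by (auto simp: sinks_def)

lemma sinks_Union:
  assumes "\<And>A. A \<in> F \<Longrightarrow> sinks N A = {}"
  shows "sinks N (\<Union>F) = {}"
proof -
  have "N v \<inter> \<Union>F \<noteq> {}" if "A \<in> F" "v \<in> A" for A v
  proof -
    have "N v \<inter> A \<noteq> {}" using assms that by (auto simp: sinks_eq_empty_iff)
    then show ?thesis using \<open>A \<in> F\<close> by blast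
  qed
  then show ?thesis by (auto simp: sinks_eq_empty_iff)
qed

lemma sources_nonempty_if_no_sinkless_subset:
  assumes "finite A" "A \<noteq> {}" and no_sinkless: "\<And>C. C \<subseteq> A \<Longrightarrow> C \<noteq> {} \<Longrightarrow> sinks N C \<noteq> {}"
  shows "sources N A \<noteq> {}"
proof -
  define E where "E = {(u, v). u \<in> A \<and> v \<in> A \<and> v \<in> N u}"
  have "wf (E\<inverse>)"
  proof (rule wfI_min)
    fix v Q assume "v \<in> (Q :: 'a set)"
    show "\<exists>z\<in>Q. \<forall>u. (u, z) \<in> E\<inverse> \<longrightarrow> u \<notin> Q"
    proof (cases "Q \<inter> A = {}")
      case True
      then show ?thesis using \<open>v \<in> Q\<close> unfolding E_def by blast
    next
      case False
      then obtain z where "z \<in> Q \<inter> A" "N z \<inter> (Q \<inter> A) = {}"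
        using no_sinkless[of "Q \<inter> A"] unfolding sinks_def by blast
      then show ?thesis unfolding E_def by blast
    qed
  qed
  then have "acyclic E" using wf_acyclic acyclic_converse by blast
  moreover have "finite E"
    using assms(1) unfolding E_def by (auto intro: finite_subset[of _ "A \<times> A"])
  ultimately have "wf E" by (simp add: finite_acyclic_wf)
  moreover obtain a where "a \<in> A" using assms(2) by blast
  ultimately obtain r where "r \<in> A" "\<And>u. (u, r) \<in> E \<Longrightarrow> u \<notin> A"
    using wfE_min[of E a A] by blast
  then show ?thesis unfolding sources_def E_def by blast
qed

definition friendly_side :: "'a set \<Rightarrow> ('a \<Rightarrow> 'a set) \<Rightarrow> 'a set \<Rightarrow> bool" where
  "friendly_side V N A \<longleftrightarrow>
     A \<subseteq> V \<and> A \<noteq> {} \<and> V - A \<noteq> {} \<and> sinks N A = {} \<and> sinks N (V - A) = {}"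

lemma friendly_side_extending:
  assumes sinkless_V: "sinks N V = {}"
    and AB: "A \<subseteq> V" "B \<subseteq> V" "A \<inter> B = {}" "A \<noteq> {}" "B \<noteq> {}" "sinks N A = {}" "sinks N B = {}"
  obtains S where "friendly_side V N S" "A \<subseteq> S" "B \<subseteq> V - S"
proof -
  \<comment> \<open>By maximality of \<open>S\<close>, only vertices of \<open>B\<close> have an arc into \<open>S\<close> from outside.\<close>
  define S where "S = \<Union>{X. X \<subseteq> V - B \<and> sinks N X = {}}"
  have S: "S \<subseteq> V - B" "A \<subseteq> S" unfolding S_def using AB by blast+
  have sinkless_S: "sinks N S = {}" unfolding S_def by (rule sinks_Union) simp
  have "N v \<inter> (V - S) \<noteq> {}" if v: "v \<in> V - S" for v
  proof (cases "v \<in> B")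
    case True
    then have "N v \<inter> B \<noteq> {}" using AB(7) by (simp add: sinks_eq_empty_iff)
    then show ?thesis using AB(2) S(1) by blast
  next
    case False
    have "N v \<inter> S = {}"
    proof (rule ccontr)
      assume "N v \<inter> S \<noteq> {}"
      then have "sinks N (insert v S) = {}" using sinkless_S unfolding sinks_def by blast
      moreover have "insert v S \<subseteq> V - B" using v False S(1) by blast
      ultimately have "v \<in> S" unfolding S_def by blast
      then show False using v by blast
    qed
    then show ?thesis using v sinkless_V unfolding sinks_def by blast
  qed
  then have "sinks N (V - S) = {}" by (simp add: sinks_eq_empty_iff)
  then have "friendly_side V N S" using S sinkless_S AB unfolding friendly_side_def by blast
  then show thesis using that S AB by blast
qed

definition two_friendly_partitions :: "'a set \<Rightarrow> ('a \<Rightarrow> 'a set) \<Rightarrow> bool" where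
  "two_friendly_partitions V N \<longleftrightarrow>
     (\<exists>A B. friendly_side V N A \<and> friendly_side V N B \<and> B \<noteq> A \<and> B \<noteq> V - A)"

lemma two_friendly_partitionsI:
  assumes "friendly_side V N S" "friendly_side V N T" "p \<in> T" "q \<in> V - T" "p \<in> S \<longleftrightarrow> q \<in> S"
  shows "two_friendly_partitions V N"
proof -
  have "T \<noteq> S" "T \<noteq> V - S" using assms(3-5) by auto
  then show ?thesis using assms(1,2) unfolding two_friendly_partitions_def by blast
qed

lemma two_friendly_partitions_if_separated:
  assumes "sinks N V = {}" "friendly_side V N S"
    and "A \<subseteq> V" "B \<subseteq> V" "A \<inter> B = {}" "sinks N A = {}" "sinks N B = {}"
    and "p \<in> A" "q \<in> B" "p \<in> S \<longleftrightarrow> q \<in> S"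
  shows "two_friendly_partitions V N"
proof -
  have "A \<noteq> {}" "B \<noteq> {}" using assms by auto
  with assms obtain T where "friendly_side V N T" "A \<subseteq> T" "B \<subseteq> V - T"
    by (metis friendly_side_extending)
  then show ?thesis using assms by (intro two_friendly_partitionsI[of V N S T p q]) auto
qed

lemma two_friendly_partitions_lift:
  assumes "two_friendly_partitions W M" "W \<subseteq> V"
    and lift: "\<And>X. friendly_side W M X \<Longrightarrow> \<exists>S. friendly_side V N S \<and> S \<inter> W = X"
  shows "two_friendly_partitions V N"
proof -
  obtain A B where "friendly_side W M A" "friendly_side W M B" "B \<noteq> A" "B \<noteq> W - A"
    using assms(1) unfolding two_friendly_partitions_def by blast
  moreover from this lift obtain S T
    where "friendly_side V N S" "S \<inter> W = A" "friendly_side V N T" "T \<inter> W = B" by metis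
  moreover from calculation have "T \<noteq> S" "T \<noteq> V - S" using \<open>W \<subseteq> V\<close> by auto
  ultimately show ?thesis unfolding two_friendly_partitions_def by blast
qed

lemma two_friendly_partitions_mono:
  assumes "two_friendly_partitions W N" "W \<subseteq> V" "sinks N V = {}"
  shows "two_friendly_partitions V N"
  using assms(1,2)
proof (rule two_friendly_partitions_lift)
  fix X assume X: "friendly_side W N X"
  then have "X \<subseteq> V" "W - X \<subseteq> V" "X \<inter> (W - X) = {}" "X \<noteq> {}" "W - X \<noteq> {}"
    "sinks N X = {}" "sinks N (W - X) = {}"
    using assms(2) unfolding friendly_side_def by auto
  then obtain S where "friendly_side V N S" "X \<subseteq> S" "W - X \<subseteq> V - S"
    by (rule friendly_side_extending[OF assms(3)])
  then show "\<exists>S. friendly_side V N S \<and> S \<inter> W = X"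
    using X unfolding friendly_side_def by (intro exI[of _ S]) blast
qed

section \<open>Contraction of an arc\<close>

definition contract :: "('a \<Rightarrow> 'a set) \<Rightarrow> 'a \<Rightarrow> 'a \<Rightarrow> 'a \<Rightarrow> 'a set" where
  "contract N u v w = (if u \<in> N w then insert v (N w - {u}) else N w)"

definition contractible :: "'a set \<Rightarrow> ('a \<Rightarrow> 'a set) \<Rightarrow> 'a \<Rightarrow> 'a \<Rightarrow> bool" where
  "contractible V N u v \<longleftrightarrow>
     u \<in> V \<and> v \<in> N u \<and> u \<notin> N v \<and> (\<forall>z\<in>V. \<not> (u \<in> N z \<and> v \<in> N z))"

lemma sinks_insert_uncontract:
  assumes "sinks (contract N u v) X = {}" "v \<in> N u" "v \<in> X"
  shows "sinks N (insert u X) = {}"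
proof -
  have "N p \<inter> insert u X \<noteq> {}" if "p \<in> X" for p
  proof -
    have "contract N u v p \<inter> X \<noteq> {}" using assms(1) that by (simp add: sinks_eq_empty_iff)
    then show ?thesis unfolding contract_def by (auto split: if_splits)
  qed
  then show ?thesis using assms(2,3) by (auto simp: sinks_eq_empty_iff)
qed

lemma sinks_uncontract:
  assumes "sinks (contract N u v) X = {}" "v \<notin> X"
  shows "sinks N X = {}"
proof -
  have "N p \<inter> X \<noteq> {}" if "p \<in> X" for p
  proof -
    have "contract N u v p \<inter> X \<noteq> {}" using assms(1) that by (simp add: sinks_eq_empty_iff)
    then show ?thesis using assms(2) unfolding contract_def by (auto split: if_splits)
  qed
  then show ?thesis by (simp add: sinks_eq_empty_iff)
qed

lemma friendly_side_uncontract: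
  assumes side: "friendly_side (V - {u}) (contract N u v) X"
    and "u \<in> V" "v \<in> V - {u}" "v \<in> N u"
  obtains S where "friendly_side V N S" "S \<inter> (V - {u}) = X"
proof -
  have X: "X \<subseteq> V - {u}" "X \<noteq> {}" "V - {u} - X \<noteq> {}"
    "sinks (contract N u v) X = {}" "sinks (contract N u v) (V - {u} - X) = {}"
    using side unfolding friendly_side_def by auto
  show thesis
  proof (cases "v \<in> X")
    case True
    have "sinks N (insert u X) = {}" using sinks_insert_uncontract X(4) assms(4) True by metis
    moreover have "V - insert u X = V - {u} - X" by blast
    moreover have "sinks N (V - {u} - X) = {}" using sinks_uncontract X(5) True by fastforce
    ultimately have "friendly_side V N (insert u X)"
      using X assms(2) unfolding friendly_side_def by auto
    then show thesis using that X(1) by blast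
  next
    case False
    have "sinks N X = {}" using sinks_uncontract X(4) False by metis
    moreover have "V - X = insert u (V - {u} - X)" using X(1) assms(2) by blast
    moreover have "sinks N (insert u (V - {u} - X)) = {}"
      using sinks_insert_uncontract[OF X(5)] assms(3,4) False by blast
    ultimately have "friendly_side V N X" using X unfolding friendly_side_def by auto
    then show thesis using that X(1) by blast
  qed
qed

section \<open>Out-regular digraphs\<close>

locale out_regular =
  fixes V :: "'a set" and N :: "'a \<Rightarrow> 'a set" and k :: nat
  assumes finite_V: "finite V"
    and out_nbrs_subset: "v \<in> V \<Longrightarrow> N v \<subseteq> V"
    and loopfree: "v \<in> V \<Longrightarrow> v \<notin> N v"
    and card_out_nbrs: "v \<in> V \<Longrightarrow> card (N v) = k"
begin

lemma finite_out_nbrs: "v \<in> V \<Longrightarrow> finite (N v)"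
  using finite_V out_nbrs_subset finite_subset by blast

lemma sinks_V:
  assumes "0 < k"
  shows "sinks N V = {}"
proof -
  have "N v \<inter> V \<noteq> {}" if "v \<in> V" for v
    using that assms out_nbrs_subset[of v] card_out_nbrs[of v] by (auto simp: Int_absorb2)
  then show ?thesis by (simp add: sinks_eq_empty_iff)
qed

lemma in_nbhd_singleton: "v \<in> V \<Longrightarrow> in_nbhd V N {v} = {u \<in> V. v \<in> N u}"
  using loopfree by (auto simp: in_nbhd_def)

lemma friendly_side_or_out_nbrs:
  assumes A: "A \<subseteq> V" "A \<noteq> {}" "sinks N A = {}" and "card A \<le> k"
  shows "friendly_side V N A \<or> (\<exists>w\<in>V - A. N w = A)"
proof (rule disjCI)
  assume no_out_nbhd: "\<not> (\<exists>w\<in>V - A. N w = A)"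
  have "finite A" using A(1) finite_V finite_subset by blast
  obtain a where "a \<in> A" using A(2) by blast
  have "V - A \<noteq> {}"
  proof
    assume "V - A = {}"
    then have "N a \<subset> A" using \<open>a \<in> A\<close> A(1) out_nbrs_subset[of a] loopfree[of a] by blast
    then have "card (N a) < card A" using \<open>finite A\<close> psubset_card_mono by blast
    then show False using card_out_nbrs[of a] \<open>a \<in> A\<close> A(1) \<open>card A \<le> k\<close> by auto
  qed
  moreover have "N p \<inter> (V - A) \<noteq> {}" if p: "p \<in> V - A" for p
  proof
    assume "N p \<inter> (V - A) = {}"
    then have "N p \<subseteq> A" using out_nbrs_subset p by blast
    then have "N p = A"
      using \<open>finite A\<close> card_out_nbrs[of p] p \<open>card A \<le> k\<close> by (intro card_seteq) auto
    then show False using no_out_nbhd p by blast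
  qed
  ultimately show "friendly_side V N A"
    using A unfolding friendly_side_def sinks_eq_empty_iff by blast
qed

lemma friendly_side_digon:
  assumes "x \<in> V" "y \<in> N x" "x \<in> N y" "2 < k"
  shows "friendly_side V N {x, y}"
proof -
  have "{x, y} \<subseteq> V" using assms out_nbrs_subset by blast
  moreover have "sinks N {x, y} = {}" using assms by (auto simp: sinks_eq_empty_iff)
  moreover have "card {x, y} < k" using \<open>2 < k\<close> by (simp add: card_insert_if)
  moreover from this have "N w \<noteq> {x, y}" if "w \<in> V" for w using card_out_nbrs[OF that] by force
  ultimately show ?thesis using friendly_side_or_out_nbrs[of "{x, y}"] by auto
qed

lemma two_friendly_partitions_incident_digons:
  assumes "2 < k" "x \<in> V" "y \<in> N x" "x \<in> N y" "z \<in> N x" "x \<in> N z" "y \<noteq> z"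
  shows "two_friendly_partitions V N"
proof (rule two_friendly_partitionsI)
  show "friendly_side V N {x, y}" "friendly_side V N {x, z}"
    using assms friendly_side_digon by auto
  show "y \<in> V - {x, z}"
    using assms out_nbrs_subset loopfree by blast
qed auto

lemma out_regular_contract:
  assumes "contractible V N u v"
  shows "out_regular (V - {u}) (contract N u v) k"
proof
  have uv: "u \<in> V" "v \<in> N u" "u \<notin> N v" and no_common: "\<And>z. z \<in> V \<Longrightarrow> u \<in> N z \<Longrightarrow> v \<notin> N z"
    using assms unfolding contractible_def by auto
  have v: "v \<in> V - {u}" using uv out_nbrs_subset loopfree by blast
  show "finite (V - {u})" using finite_V by simp
  fix p assume p: "p \<in> V - {u}"
  show "contract N u v p \<subseteq> V - {u}"
    using p v out_nbrs_subset unfolding contract_def by auto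
  show "p \<notin> contract N u v p"
    using p uv(3) loopfree unfolding contract_def by auto
  have "card (insert v (N p - {u})) = card (N p)" if "u \<in> N p"
    using that p no_common[of p] finite_out_nbrs[of p] card.remove[of "N p" u] by simp
  then show "card (contract N u v p) = k"
    using p card_out_nbrs unfolding contract_def by simp
qed

lemma two_friendly_partitions_uncontract:
  assumes "contractible V N u v" "two_friendly_partitions (V - {u}) (contract N u v)"
  shows "two_friendly_partitions V N"
  using assms(2)
proof (rule two_friendly_partitions_lift)
  have "u \<in> V" "v \<in> N u" using assms(1) unfolding contractible_def by auto
  moreover from this have "v \<in> V - {u}" using out_nbrs_subset loopfree by blast
  ultimately show "\<exists>S. friendly_side V N S \<and> S \<inter> (V - {u}) = X"
    if "friendly_side (V - {u}) (contract N u v) X" for X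
    using that friendly_side_uncontract by metis
qed blast

section \<open>Digons\<close>

text \<open>
  Each \<open>v\<close> in the in-neighbourhood \<open>Z\<close> of \<open>D\<close> is obstructed by some \<open>u \<in> Z\<close> with out-neighbourhood
  \<open>insert v D\<close>; the map \<open>v \<mapsto> u\<close> is injective, hence a permutation of \<open>Z\<close>.
\<close>

lemma out_nbrs_if_no_friendly_insert:
  assumes D: "D \<subseteq> V" "D \<noteq> {}" "sinks N D = {}" "Suc (card D) = k"
    and no_friendly: "\<And>v. v \<in> in_nbhd V N D \<Longrightarrow> \<not> friendly_side V N (insert v D)"
    and "z \<in> in_nbhd V N D"
  obtains v where "v \<in> in_nbhd V N D" "N z = insert v D"
proof -
  let ?Z = "in_nbhd V N D"
  have "finite D" "finite ?Z" using D(1) finite_V finite_subset by (auto simp: in_nbhd_def)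
  have disjoint: "v \<notin> D" if "v \<in> ?Z" for v using that by (simp add: in_nbhd_def)
  have "\<exists>u\<in>?Z. N u = insert v D" if v: "v \<in> ?Z" for v
  proof -
    have "insert v D \<subseteq> V" "sinks N (insert v D) = {}" "card (insert v D) \<le> k"
      using v D \<open>finite D\<close> unfolding in_nbhd_def sinks_def by (auto simp: card_insert_if)
    then obtain u where "u \<in> V - insert v D" "N u = insert v D"
      using friendly_side_or_out_nbrs[of "insert v D"] no_friendly[OF v] by auto
    moreover from this have "u \<in> ?Z" using D(2) by (auto simp: in_nbhd_def)
    ultimately show ?thesis by blast
  qed
  then obtain obstruction where obstruction:
    "\<And>v. v \<in> ?Z \<Longrightarrow> obstruction v \<in> ?Z \<and> N (obstruction v) = insert v D" by metis
  have "inj_on obstruction ?Z"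
    by (rule inj_onI) (metis disjoint insert_iff obstruction)
  then have "obstruction ` ?Z = ?Z" using \<open>finite ?Z\<close> obstruction by (intro endo_inj_surj) auto
  then show thesis using that obstruction \<open>z \<in> ?Z\<close> by (metis imageE)
qed

lemma digon_dominates_if_in_nbhd_subset:
  assumes no_contractible: "\<And>u v. \<not> contractible V N u v"
    and xy: "x \<in> V" "y \<in> N x" "x \<in> N y"
    and r: "r \<in> V" "N r \<noteq> {}" "in_nbhd V N {r} \<subseteq> {x, y}" "N r \<inter> {x, y} = {}"
  shows "r \<in> N x \<inter> N y" "N r \<subseteq> N x \<union> N y"
proof -
  have "y \<in> V" using xy out_nbrs_subset by blast
  have in_nbr: "p = x \<or> p = y" if "p \<in> V" "r \<in> N p" for p
    using that r(1,3) in_nbhd_singleton by blast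
  have common: "\<exists>z\<in>V. u \<in> N z \<and> v \<in> N z" if "u \<in> V" "v \<in> N u" "u \<notin> N v" for u v
    using no_contractible[of u v] that unfolding contractible_def by blast
  have common_in_digon: "\<exists>p\<in>{x, y}. r \<in> N p \<and> q \<in> N p" if q: "q \<in> N r" for q
  proof -
    have "r \<notin> N q" using in_nbr[of q] q r(1,4) out_nbrs_subset by blast
    then show ?thesis using common[OF r(1) q] in_nbr by blast
  qed
  then show "N r \<subseteq> N x \<union> N y" by auto
  have "r \<in> N y" if "r \<in> N x"
    using common[OF xy(1) that] in_nbr loopfree[OF xy(1)] r(4) by blast
  moreover have "r \<in> N x" if "r \<in> N y"
    using common[OF \<open>y \<in> V\<close> that] in_nbr loopfree[OF \<open>y \<in> V\<close>] r(4) by blast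
  ultimately show "r \<in> N x \<inter> N y" using common_in_digon r(2) by blast
qed

lemma out_nbr_in_digon_if_in_nbhd_subset:
  assumes no_contractible: "\<And>u v. \<not> contractible V N u v"
    and "0 < k" "k \<le> 3"
    and xy: "x \<in> V" "y \<in> N x" "x \<in> N y"
    and r: "r \<in> V" "in_nbhd V N {r} \<subseteq> {x, y}"
  shows "N r \<inter> {x, y} \<noteq> {}"
proof
  assume disjoint: "N r \<inter> {x, y} = {}"
  have "y \<in> V" using xy out_nbrs_subset by blast
  have "N r \<noteq> {}" using card_out_nbrs[OF r(1)] \<open>0 < k\<close> by auto
  note common = digon_dominates_if_in_nbhd_subset[OF no_contractible xy r(1) this r(2) disjoint]
  have "r \<noteq> x" "r \<noteq> y" using common(1) loopfree xy(1) \<open>y \<in> V\<close> by auto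
  then have cards: "card (N x - {y, r}) = k - 2" "card (N y - {x, r}) = k - 2"
    using common(1) xy \<open>y \<in> V\<close> by (simp_all add: card_Diff_subset card_out_nbrs)
  have "N r \<subseteq> (N x - {y, r}) \<union> (N y - {x, r})"
    using common(2) disjoint loopfree[OF r(1)] loopfree[OF xy(1)] loopfree[OF \<open>y \<in> V\<close>] by blast
  then have "card (N r) \<le> card ((N x - {y, r}) \<union> (N y - {x, r}))"
    using finite_out_nbrs xy(1) \<open>y \<in> V\<close> by (intro card_mono) auto
  also have "\<dots> \<le> (k - 2) + (k - 2)" using card_Un_le cards by metis
  finally show False using card_out_nbrs[OF r(1)] \<open>0 < k\<close> \<open>k \<le> 3\<close> by linarith
qed

lemma sinkless_subset_outside_dominating_in_nbhd:
  assumes no_contractible: "\<And>u v. \<not> contractible V N u v"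
    and "k = 3"
    and xy: "x \<in> V" "y \<in> N x" "x \<in> N y"
    and dominating: "\<And>z. z \<in> in_nbhd V N {x, y} \<Longrightarrow> \<exists>v\<in>in_nbhd V N {x, y}. N z = insert v {x, y}"
    and disjoint: "N x \<inter> in_nbhd V N {x, y} = {}"
  obtains C where "C \<subseteq> V - {x, y} - in_nbhd V N {x, y}" "C \<noteq> {}" "sinks N C = {}"
proof -
  define Z where "Z = in_nbhd V N {x, y}"
  define R where "R = V - {x, y} - Z"
  have "\<not> N x \<subseteq> {y}"
    using card_mono[of "{y}" "N x"] card_out_nbrs[OF xy(1)] \<open>k = 3\<close> by auto
  then have "R \<noteq> {}"
    using disjoint out_nbrs_subset[OF xy(1)] loopfree[OF xy(1)] unfolding R_def Z_def by blast
  have "sources N R = {}"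
  proof (rule ccontr)
    assume "sources N R \<noteq> {}"
    then obtain r where r: "r \<in> R" "\<And>p. p \<in> R \<Longrightarrow> r \<notin> N p" unfolding sources_def by blast
    have "r \<notin> N p" if p: "p \<in> Z" for p
    proof -
      obtain v where "v \<in> Z" "N p = insert v {x, y}"
        using dominating p unfolding Z_def by blast
      then show ?thesis using r(1) unfolding R_def by auto
    qed
    with r have "in_nbhd V N {r} \<subseteq> {x, y}" unfolding R_def in_nbhd_def by blast
    then have "N r \<inter> {x, y} \<noteq> {}"
      using out_nbr_in_digon_if_in_nbhd_subset[OF no_contractible] xy r(1) \<open>k = 3\<close>
      unfolding R_def by simp
    then show False using r(1) unfolding R_def Z_def in_nbhd_def by blast
  qed
  moreover have "finite R" using finite_V unfolding R_def by simp
  ultimately show thesis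
    using that sources_nonempty_if_no_sinkless_subset[OF _ \<open>R \<noteq> {}\<close>]
    unfolding R_def Z_def by metis
qed

lemma two_friendly_partitions_dominating_in_nbhd:
  assumes no_contractible: "\<And>u v. \<not> contractible V N u v"
    and "k = 3"
    and xy: "x \<in> V" "y \<in> N x" "x \<in> N y"
    and nonempty: "in_nbhd V N {x, y} \<noteq> {}"
    and dominating: "\<And>z. z \<in> in_nbhd V N {x, y} \<Longrightarrow> \<exists>v\<in>in_nbhd V N {x, y}. N z = insert v {x, y}"
  shows "two_friendly_partitions V N"
proof (cases "N x \<inter> in_nbhd V N {x, y} = {}")
  case False
  then obtain s where s: "s \<in> N x" "s \<in> in_nbhd V N {x, y}" by blast
  then have "x \<in> N s" using dominating by blast
  moreover have "y \<noteq> s" using s(2) unfolding in_nbhd_def by blast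
  ultimately show ?thesis
    using two_friendly_partitions_incident_digons xy s(1) \<open>k = 3\<close> by simp
next
  case True
  let ?Z = "in_nbhd V N {x, y}"
  obtain C where C: "C \<subseteq> V - {x, y} - ?Z" "C \<noteq> {}" "sinks N C = {}"
    using sinkless_subset_outside_dominating_in_nbhd[OF no_contractible \<open>k = 3\<close> xy dominating True]
    by blast
  have Z: "?Z \<subseteq> V - {x, y}" by (auto simp: in_nbhd_def)
  have sinkless_Z: "sinks N ?Z = {}"
    using dominating unfolding sinks_eq_empty_iff by blast
  have digon: "friendly_side V N {x, y}" using friendly_side_digon xy \<open>k = 3\<close> by simp
  obtain z c where "z \<in> ?Z" "c \<in> C" using nonempty C(2) by blast
  then show ?thesis
    using C Z sinkless_Z sinks_V \<open>k = 3\<close>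
    by (intro two_friendly_partitions_if_separated[OF _ digon, of ?Z C z c]) auto
qed

lemma two_friendly_partitions_digon:
  assumes no_contractible: "\<And>u v. \<not> contractible V N u v"
    and "k = 3"
    and xy: "x \<in> V" "y \<in> N x" "x \<in> N y"
    and smaller: "\<And>W. W \<subset> V \<Longrightarrow> W \<noteq> {} \<Longrightarrow> out_regular W N k \<Longrightarrow> two_friendly_partitions W N"
  shows "two_friendly_partitions V N"
proof -
  let ?Z = "in_nbhd V N {x, y}"
  have digon: "friendly_side V N {x, y}" using friendly_side_digon xy \<open>k = 3\<close> by simp
  consider (closed) "?Z = {}"
    | (friendly_insert) v where "v \<in> ?Z" "friendly_side V N (insert v {x, y})"
    | (no_friendly_insert) "?Z \<noteq> {}" "\<And>v. v \<in> ?Z \<Longrightarrow> \<not> friendly_side V N (insert v {x, y})"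
    by blast
  then show ?thesis
  proof cases
    case closed
    have "out_regular (V - {x, y}) N k"
    proof
      show "N v \<subseteq> V - {x, y}" if "v \<in> V - {x, y}" for v
        using that closed out_nbrs_subset unfolding in_nbhd_def by blast
    qed (use finite_V loopfree card_out_nbrs in auto)
    moreover have "V - {x, y} \<noteq> {}" using digon unfolding friendly_side_def by blast
    ultimately have "two_friendly_partitions (V - {x, y}) N"
      using smaller[of "V - {x, y}"] xy(1) by blast
    then show ?thesis by (rule two_friendly_partitions_mono) (use sinks_V \<open>k = 3\<close> in auto)
  next
    case friendly_insert
    then show ?thesis
      using digon by (intro two_friendly_partitionsI[of V N "insert v {x, y}" "{x, y}" x v])
        (auto simp: in_nbhd_def)
  next
    case no_friendly_insert
    have "{x, y} \<subseteq> V" "sinks N {x, y} = {}" using digon unfolding friendly_side_def by auto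
    moreover have "x \<noteq> y" using xy loopfree by blast
    then have "Suc (card {x, y}) = k" using \<open>k = 3\<close> by simp
    ultimately have "\<exists>v\<in>?Z. N z = insert v {x, y}" if "z \<in> ?Z" for z
      using out_nbrs_if_no_friendly_insert[of "{x, y}" z] no_friendly_insert(2) that by blast
    then show ?thesis
      using two_friendly_partitions_dominating_in_nbhd no_contractible \<open>k = 3\<close> xy
        no_friendly_insert(1) by blast
  qed
qed

end

section \<open>Digraphs without digons\<close>

lemma card_ge_3_if_sourceless:
  assumes "finite A" "A \<noteq> {}" "sources N A = {}" and asym: "asymp_on A (\<lambda>u v. v \<in> N u)"
  shows "3 \<le> card A"
proof -
  have in_nbr: "\<exists>u\<in>A. v \<in> N u" if "v \<in> A" for v using that assms(3) unfolding sources_def by blast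
  obtain c where "c \<in> A" using assms(2) by blast
  with in_nbr obtain b where b: "b \<in> A" "c \<in> N b" by blast
  with in_nbr obtain a where a: "a \<in> A" "b \<in> N a" by blast
  have "a \<noteq> b" "b \<noteq> c" "a \<noteq> c" using asymp_onD[OF asym] a b \<open>c \<in> A\<close> by blast+
  then have "card {a, b, c} = 3" by simp
  then show ?thesis using card_mono[of A "{a, b, c}"] a b \<open>c \<in> A\<close> assms(1) by simp
qed

lemma sinkless_if_sourceless_card_3:
  assumes "card A = 3" "sources N A = {}" and asym: "asymp_on A (\<lambda>u v. v \<in> N u)"
  shows "sinks N A = {}"
proof (rule ccontr)
  assume "sinks N A \<noteq> {}"
  then obtain w where w: "w \<in> A" "N w \<inter> A = {}" unfolding sinks_def by blast
  define B where "B = A - {w}"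
  have "card B = 2" using w(1) assms(1) unfolding B_def by simp
  then have "finite B" "B \<noteq> {}" by (auto intro: card_ge_0_finite)
  moreover have "sources N B = {}" using w(2) assms(2) unfolding sources_def B_def by blast
  moreover have "asymp_on B (\<lambda>u v. v \<in> N u)" using asym asymp_on_subset unfolding B_def by blast
  ultimately have "3 \<le> card B" by (rule card_ge_3_if_sourceless)
  with \<open>card B = 2\<close> show False by simp
qed

context out_regular
begin

lemma card_in_nbhd_eq:
  assumes "\<And>v. v \<in> V \<Longrightarrow> k \<le> card (in_nbhd V N {v})" "v \<in> V"
  shows "card (in_nbhd V N {v}) = k"
proof -
  have "card {v \<in> V. v \<in> N u} = k" if "u \<in> V" for u
    using that out_nbrs_subset card_out_nbrs by (simp add: Collect_conj_eq Int_absorb1)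
  then have "(\<Sum>v\<in>V. card {u \<in> V. v \<in> N u}) = k * card V"
    by (intro sum_multicount finite_V) simp
  then have "(\<Sum>v\<in>V. k) = (\<Sum>v\<in>V. card (in_nbhd V N {v}))"
    by (simp add: in_nbhd_singleton mult.commute)
  then show ?thesis by (rule sum_mono_inv[OF _ assms finite_V, symmetric])
qed

context
  assumes no_contractible: "\<And>u v. \<not> contractible V N u v"
    and oriented: "asymp_on V (\<lambda>u v. v \<in> N u)"
begin

lemma arc_common_in_nbr:
  assumes "u \<in> V" "v \<in> N u"
  obtains z where "z \<in> V" "u \<in> N z" "v \<in> N z"
proof -
  have "v \<in> V" using assms out_nbrs_subset by blast
  then have "u \<notin> N v" using assms asymp_onD[OF oriented] by blast
  then show thesis using that no_contractible[of u v] assms unfolding contractible_def by blast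
qed

lemma sources_in_nbhd:
  assumes "v \<in> V"
  shows "sources N (in_nbhd V N {v}) = {}"
proof -
  have "\<exists>z\<in>in_nbhd V N {v}. u \<in> N z" if "u \<in> in_nbhd V N {v}" for u
  proof -
    have "u \<in> V" "v \<in> N u" using that assms by (simp_all add: in_nbhd_singleton)
    then obtain z where "z \<in> V" "u \<in> N z" "v \<in> N z" by (rule arc_common_in_nbr)
    then show ?thesis using assms by (auto simp: in_nbhd_singleton)
  qed
  then show ?thesis unfolding sources_def by blast
qed

lemma in_nbhd_nonempty:
  assumes "0 < k" "v \<in> V"
  shows "in_nbhd V N {v} \<noteq> {}"
proof -
  obtain w where "w \<in> N v" using sinks_V assms unfolding sinks_def by blast
  then obtain z where "z \<in> V" "v \<in> N z" using arc_common_in_nbr assms(2) by blast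
  then show ?thesis using assms(2) by (auto simp: in_nbhd_singleton)
qed

lemma sinks_in_nbhd:
  assumes "k = 3" "v \<in> V"
  shows "sinks N (in_nbhd V N {v}) = {}"
proof (rule sinkless_if_sourceless_card_3)
  have asym: "asymp_on (in_nbhd V N {v}) (\<lambda>u v. v \<in> N u)" for v
    using oriented by (rule asymp_on_subset) (auto simp: in_nbhd_def)
  then show "asymp_on (in_nbhd V N {v}) (\<lambda>u v. v \<in> N u)" .
  have "finite (in_nbhd V N {v})" for v using finite_V by (simp add: in_nbhd_def)
  then have "3 \<le> card (in_nbhd V N {v})" if "v \<in> V" for v
    using card_ge_3_if_sourceless[OF _ _ _ asym] in_nbhd_nonempty sources_in_nbhd that \<open>k = 3\<close>
    by simp
  then show "card (in_nbhd V N {v}) = 3" using card_in_nbhd_eq assms by blast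
qed (use sources_in_nbhd assms in blast)

lemma sinks_out_nbrs:
  assumes "k = 3" "w \<in> V"
  shows "sinks N (N w) = {}"
proof (rule sinkless_if_sourceless_card_3)
  show "card (N w) = 3" using card_out_nbrs assms by simp
  show "asymp_on (N w) (\<lambda>u v. v \<in> N u)"
    using oriented out_nbrs_subset[OF assms(2)] by (rule asymp_on_subset)
  have "\<exists>c\<in>N w. a \<in> N c" if a: "a \<in> N w" for a
  proof -
    have "a \<in> V" using a assms(2) out_nbrs_subset by blast
    moreover from this have "w \<in> in_nbhd V N {a}" using a assms(2) by (simp add: in_nbhd_singleton)
    ultimately have "N w \<inter> in_nbhd V N {a} \<noteq> {}"
      using sinks_in_nbhd assms(1) unfolding sinks_eq_empty_iff by blast
    then show ?thesis using \<open>a \<in> V\<close> by (auto simp: in_nbhd_singleton)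
  qed
  then show "sources N (N w) = {}" unfolding sources_def by blast
qed

lemma out_nbrs_Int_in_nbhd: "w \<in> V \<Longrightarrow> N w \<inter> in_nbhd V N {w} = {}"
  using asymp_onD[OF oriented] out_nbrs_subset by (auto simp: in_nbhd_singleton)

lemma two_friendly_partitions_oriented:
  assumes "k = 3" "V \<noteq> {}"
  shows "two_friendly_partitions V N"
proof -
  let ?I = "\<lambda>v. in_nbhd V N {v}"
  have sinkless_V: "sinks N V = {}" using sinks_V \<open>k = 3\<close> by simp
  have I_subset: "?I v \<subseteq> V" for v by (auto simp: in_nbhd_def)
  note sinkless_nbhds = sinks_out_nbrs[OF \<open>k = 3\<close>] sinks_in_nbhd[OF \<open>k = 3\<close>]
  obtain w where w: "w \<in> V" using \<open>V \<noteq> {}\<close> by blast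
  then have "N w \<noteq> {}" using card_out_nbrs \<open>k = 3\<close> by fastforce
  then obtain a c where ac: "c \<in> N w" "a \<in> N w" "a \<in> N c"
    using sinkless_nbhds(1)[OF w] unfolding sinks_eq_empty_iff by blast
  then have "a \<in> V" "c \<in> V" using w out_nbrs_subset by blast+
  then have "c \<in> ?I a" using ac by (simp add: in_nbhd_singleton)
  then obtain z where "z \<in> N c" "z \<in> ?I a"
    using sinkless_nbhds(2)[OF \<open>a \<in> V\<close>] unfolding sinks_eq_empty_iff by blast
  then have z: "z \<in> V" "a \<in> N z" "c \<in> ?I z"
    using \<open>a \<in> V\<close> \<open>c \<in> V\<close> by (auto simp: in_nbhd_singleton)
  have "?I w \<noteq> {}" using in_nbhd_nonempty \<open>k = 3\<close> w by simp
  with w \<open>N w \<noteq> {}\<close> obtain S where "friendly_side V N S" "N w \<subseteq> S"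
    using friendly_side_extending[OF sinkless_V out_nbrs_subset I_subset] out_nbrs_Int_in_nbhd
      sinkless_nbhds by metis
  then show ?thesis
    using z ac out_nbrs_subset out_nbrs_Int_in_nbhd sinkless_nbhds
    by (intro two_friendly_partitions_if_separated[OF sinkless_V, of S "N z" "?I z" a c] I_subset)
      auto
qed

end

end

lemma two_friendly_partitions_out_regular_3:
  assumes "out_regular V N 3" "V \<noteq> {}"
  shows "two_friendly_partitions V N"
  using assms
proof (induction "card V" arbitrary: V N rule: less_induct)
  case less
  interpret out_regular V N 3 by (rule less.prems(1))
  have smaller: "two_friendly_partitions W M"
    if "W \<subset> V" "W \<noteq> {}" "out_regular W M 3" for W M
    using less.hyps that psubset_card_mono[OF finite_V] by blast
  consider (contractible) u v where "contractible V N u v"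
    | (digon) x y where "x \<in> V" "y \<in> N x" "x \<in> N y" "\<And>u v. \<not> contractible V N u v"
    | (oriented) "asymp_on V (\<lambda>u v. v \<in> N u)" "\<And>u v. \<not> contractible V N u v"
    unfolding asymp_on_def by blast
  then show ?case
  proof cases
    case contractible
    then have "V - {u} \<subset> V" "V - {u} \<noteq> {}"
      using out_nbrs_subset loopfree unfolding contractible_def by blast+
    then have "two_friendly_partitions (V - {u}) (contract N u v)"
      using smaller out_regular_contract[OF contractible] by blast
    then show ?thesis using two_friendly_partitions_uncontract contractible by blast
  next
    case digon
    then show ?thesis using two_friendly_partitions_digon smaller by blast
  next
    case oriented
    then show ?thesis using two_friendly_partitions_oriented less.prems(2) by blast
  qed
qed

section \<open>Friendly partitions of a digraph\<close>

lemma (in digraph) card_dominated_eq_out_degree: "card {w. v \<rightarrow>\<^bsub>G\<^esub> w} = out_degree G v"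
proof -
  have "{w. v \<rightarrow>\<^bsub>G\<^esub> w} = head G ` out_arcs G v"
    by (auto simp: arcs_ends_conv)
  moreover have "inj_on (head G) (out_arcs G v)"
    using no_multi_arcs by (auto simp: inj_on_def arc_to_ends_def)
  ultimately show ?thesis unfolding out_degree_def by (simp add: card_image)
qed

lemma (in digraph) out_regular_subdigraph:
  assumes "k \<le> min_out_degree G"
  obtains N where "out_regular (verts G) N k" "\<And>v w. v \<in> verts G \<Longrightarrow> w \<in> N v \<Longrightarrow> v \<rightarrow>\<^bsub>G\<^esub> w"
proof -
  have "\<exists>T \<subseteq> {w. v \<rightarrow>\<^bsub>G\<^esub> w}. card T = k" if "v \<in> verts G" for v
  proof -
    have "min_out_degree G \<le> out_degree G v"
      using that unfolding min_out_degree_def by simp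
    then have "k \<le> card {w. v \<rightarrow>\<^bsub>G\<^esub> w}"
      using assms card_dominated_eq_out_degree by simp
    then show ?thesis using obtain_subset_with_card_n by metis
  qed
  then obtain N where N: "\<And>v. v \<in> verts G \<Longrightarrow> N v \<subseteq> {w. v \<rightarrow>\<^bsub>G\<^esub> w} \<and> card (N v) = k"
    by metis
  have "out_regular (verts G) N k"
    by standard (use finite_verts N adj_in_verts adj_not_same in blast)+
  then show thesis using that N by blast
qed

lemma friendly_partition_friendly_side:
  assumes "friendly_side (verts G) N X"
    and "\<And>v w. v \<in> verts G \<Longrightarrow> w \<in> N v \<Longrightarrow> v \<rightarrow>\<^bsub>G\<^esub> w"
  shows "friendly_partition G {X, verts G - X}"
proof -
  have X: "X \<subseteq> verts G" "X \<noteq> {}" "verts G - X \<noteq> {}" "sinks N X = {}" "sinks N (verts G - X) = {}"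
    using assms(1) unfolding friendly_side_def by auto
  then have "partition_on (verts G) {X, verts G - X}"
    by (intro partition_onI) (auto simp: disjnt_def)
  moreover have "X \<noteq> verts G - X" using X(2) by blast
  then have "card {X, verts G - X} = 2" by simp
  moreover have "\<exists>w\<in>Y. v \<rightarrow>\<^bsub>G\<^esub> w" if "Y \<in> {X, verts G - X}" "v \<in> Y" for Y v
  proof -
    have "v \<in> verts G" "N v \<inter> Y \<noteq> {}" using that X unfolding sinks_def by auto
    then show ?thesis using assms(2) by blast
  qed
  ultimately show ?thesis unfolding friendly_partition_def by blast
qed

lemma finite_friendly_partitions:
  assumes "finite (verts G)"
  shows "finite {P. friendly_partition G P}"
  using finitely_many_partition_on[OF assms]
  by (rule rev_finite_subset) (auto simp: friendly_partition_def)

theorem theorem1p7: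
  fixes G :: "('a, 'b) pre_digraph"
  assumes "digraph G"
    and "verts G \<noteq> {}"
    and "min_out_degree G \<ge> 3"
  shows "card {P. friendly_partition G P} \<ge> 2"
proof -
  interpret digraph G by (rule assms(1))
  let ?V = "verts G"
  obtain N where "out_regular ?V N 3" and arcs: "\<And>v w. v \<in> ?V \<Longrightarrow> w \<in> N v \<Longrightarrow> v \<rightarrow>\<^bsub>G\<^esub> w"
    using out_regular_subdigraph[OF assms(3)] by blast
  then have "two_friendly_partitions ?V N"
    using two_friendly_partitions_out_regular_3 assms(2) by blast
  then obtain A B where AB: "friendly_side ?V N A" "friendly_side ?V N B" "B \<noteq> A" "B \<noteq> ?V - A"
    unfolding two_friendly_partitions_def by blast
  then have "{A, ?V - A} \<noteq> {B, ?V - B}" by (auto simp: doubleton_eq_iff)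
  then have "card {{A, ?V - A}, {B, ?V - B}} = 2" by simp
  moreover have "{{A, ?V - A}, {B, ?V - B}} \<subseteq> {P. friendly_partition G P}"
    using AB(1,2) arcs friendly_partition_friendly_side by blast
  ultimately show ?thesis
    using card_mono[OF finite_friendly_partitions[OF finite_verts]] by metis
qed

end
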